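(* Let $G$ be an Eulerian circulant graph of order $n$ and degree $d$, and suppose that $G$ admits a set of $k$ mutually avoiding Eulerian circuits (all starting and ending at a common vertex). Then there exists a graph of order $2n$ and degree $2d$ which also admits a set of $k$ mutually avoiding Eulerian circuits (all starting and ending at a common vertex).
   Context: All graphs are finite, simple and connected. A circulant graph of order $n$ is a Cayley graph on $\mathbb{Z}_n$. An Eulerian circuit is a closed trail traversing every edge exactly once. For an Eulerian graph with $m$ edges and vertex $x$, two Eulerian circuits $x,v_1,\ldots,v_{m-1},x$ and $x,w_1,\ldots,w_{m-1},x$ are avoiding if for each $1\le i\le m-1$, $v_i\ne w_i$ and $v_i,w_i$ are non-adjacent; a set of Eulerian circuits is mutually avoiding if they are pairwise avoiding. *)

theory Defs
  imports "HOL-Algebra.Elementary_Groups"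
begin

record 'a ugraph =
  verts :: "'a set"
  edges :: "'a set set"

definition adj :: "'a ugraph \<Rightarrow> 'a \<Rightarrow> 'a \<Rightarrow> bool" where
  "adj G u v \<longleftrightarrow> {u, v} \<in> edges G"

definition finite_simple_graph :: "'a ugraph \<Rightarrow> bool" where
  "finite_simple_graph G \<longleftrightarrow>
     finite (verts G) \<and> (\<forall>e\<in>edges G. e \<subseteq> verts G \<and> card e = 2)"

text \<open>Walks are represented by their nonempty vertex sequences, which determine the edges
  traversed because the graphs are simple.\<close>

definition walk :: "'a ugraph \<Rightarrow> 'a list \<Rightarrow> bool" where
  "walk G p \<longleftrightarrow> p \<noteq> [] \<and> set p \<subseteq> verts G \<and> successively (adj G) p"

definition walk_edges :: "'a list \<Rightarrow> 'a set list" where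
  "walk_edges p = map (\<lambda>(u, v). {u, v}) (zip p (tl p))"

definition connected_graph :: "'a ugraph \<Rightarrow> bool" where
  "connected_graph G \<longleftrightarrow> verts G \<noteq> {} \<and>
     (\<forall>u\<in>verts G. \<forall>v\<in>verts G. \<exists>p. walk G p \<and> hd p = u \<and> last p = v)"

definition vertex_degree :: "'a ugraph \<Rightarrow> 'a \<Rightarrow> nat" where
  "vertex_degree G v = card {u. adj G v u}"

definition regular_graph :: "'a ugraph \<Rightarrow> nat \<Rightarrow> bool" where
  "regular_graph G d \<longleftrightarrow> (\<forall>v\<in>verts G. vertex_degree G v = d)"

definition graph_iso :: "'a ugraph \<Rightarrow> 'b ugraph \<Rightarrow> bool" where
  "graph_iso G H \<longleftrightarrow> (\<exists>f. bij_betw f (verts G) (verts H) \<and>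
     (\<forall>u\<in>verts G. \<forall>v\<in>verts G. adj G u v \<longleftrightarrow> adj H (f u) (f v)))"

definition cayley_graph :: "('a, 'b) monoid_scheme \<Rightarrow> 'a set \<Rightarrow> 'a ugraph" where
  "cayley_graph \<Gamma> S =
     \<lparr>verts = carrier \<Gamma>,
      edges = {{g, g \<otimes>\<^bsub>\<Gamma>\<^esub> s} | g s. g \<in> carrier \<Gamma> \<and> s \<in> S}\<rparr>"

text \<open>The condition \<open>n > 0\<close> is needed because the library's \<open>integer_mod_group 0\<close> is the infinite
  group of all integers.\<close>

definition circulant_graph :: "'a ugraph \<Rightarrow> nat \<Rightarrow> bool" where
  "circulant_graph G n \<longleftrightarrow> n > 0 \<and>
     (\<exists>S. S \<subseteq> carrier (integer_mod_group n) - {\<one>\<^bsub>integer_mod_group n\<^esub>} \<and>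
          (\<forall>s\<in>S. inv\<^bsub>integer_mod_group n\<^esub> s \<in> S) \<and>
          graph_iso G (cayley_graph (integer_mod_group n) S))"

text \<open>An Eulerian circuit \<open>x, v\<^sub>1, \<dots>, v\<^bsub>m-1\<^esub>, x\<close> in a graph with \<open>m\<close> edges is a list of length
  \<open>m + 1\<close> that includes both occurrences of \<open>x\<close> as its ends. The condition on the length
  excludes the one-vertex walk, so that the edgeless one-vertex graph is not Eulerian.\<close>

definition eulerian_circuit :: "'a ugraph \<Rightarrow> 'a list \<Rightarrow> bool" where
  "eulerian_circuit G p \<longleftrightarrow> walk G p \<and> length p \<ge> 2 \<and> hd p = last p \<and>
     distinct (walk_edges p) \<and> set (walk_edges p) = edges G"

definition eulerian_graph :: "'a ugraph \<Rightarrow> bool" where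
  "eulerian_graph G \<longleftrightarrow> (\<exists>p. eulerian_circuit G p)"

definition avoiding :: "'a ugraph \<Rightarrow> 'a list \<Rightarrow> 'a list \<Rightarrow> bool" where
  "avoiding G p q \<longleftrightarrow> eulerian_circuit G p \<and> eulerian_circuit G q \<and> hd p = hd q \<and>
     (\<forall>i\<in>{1..card (edges G) - 1}. p ! i \<noteq> q ! i \<and> \<not> adj G (p ! i) (q ! i))"

definition admits_avoiding_circuits :: "'a ugraph \<Rightarrow> nat \<Rightarrow> bool" where
  "admits_avoiding_circuits G k \<longleftrightarrow> (\<exists>x\<in>verts G. \<exists>C. finite C \<and> card C = k \<and>
     (\<forall>p\<in>C. eulerian_circuit G p \<and> hd p = x) \<and> pairwise (avoiding G) C)"

end

theory Submission
  imports Defs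
begin

text \<open>Take for the new graph the lexicographic product of \<open>G\<close> with two isolated vertices.
  Before the last edge of each given circuit \<open>p\<close>, lifted to layer \<open>False\<close>, insert a translate,
  by the circulant structure, of one fixed closed trail \<open>T\<close> through all edges outside layer
  \<open>False\<close>. The last but one vertices of the circuits are pairwise distinct and non-adjacent, and
  translations of the cyclic group preserve this, so the circuits keep avoiding each other while
  they run through the translates of \<open>T\<close> in parallel.\<close>

section \<open>Edge lists of walks and Eulerian circuits\<close>

lemma walk_edges_simps [simp]:
  "walk_edges [] = []" "walk_edges [x] = []"
  "walk_edges (x # y # p) = {x, y} # walk_edges (y # p)"
  by (simp_all add: walk_edges_def)

lemma length_walk_edges: "length (walk_edges p) = length p - 1"
  by (simp add: walk_edges_def)

lemma walk_edges_conv_nth: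
  "walk_edges p = map (\<lambda>t. {p ! t, p ! Suc t}) [0..<length p - 1]"
  by (rule nth_equalityI) (auto simp: walk_edges_def nth_tl)

lemma walk_edges_append:
  "xs \<noteq> [] \<Longrightarrow> walk_edges (xs @ ys) = walk_edges xs @ walk_edges (last xs # ys)"
proof (induction xs)
  case (Cons a xs)
  then show ?case by (cases xs) auto
qed simp

text \<open>The shared end vertex is kept once: the edge from \<open>last xs\<close> into
  \<open>tl ys\<close> is the first edge of \<open>ys\<close>.\<close>

lemma walk_edges_join:
  assumes "xs \<noteq> []" "ys \<noteq> []" "last xs = hd ys"
  shows "walk_edges (xs @ tl ys) = walk_edges xs @ walk_edges ys"
  using assms by (simp add: walk_edges_append)

lemma walk_edges_map: "walk_edges (map g p) = map (image g) (walk_edges p)"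
  by (auto simp: walk_edges_conv_nth)

lemma successively_adj_iff: "successively (adj G) p \<longleftrightarrow> set (walk_edges p) \<subseteq> edges G"
  by (induction p rule: induct_list012) (auto simp: adj_def)

lemma set_subset_walk_edges: "length p \<ge> 2 \<Longrightarrow> set p \<subseteq> \<Union> (set (walk_edges p))"
proof (induction p rule: induct_list012)
  case (3 x y zs)
  then show ?case by (cases zs) auto
qed auto

lemma adj_verts:
  assumes "finite_simple_graph G" "adj G u v"
  shows "u \<in> verts G" "v \<in> verts G" "u \<noteq> v"
  using assms by (force simp: finite_simple_graph_def adj_def)+

lemma edge_cases:
  assumes "finite_simple_graph G" "e \<in> edges G"
  obtains u v where "e = {u, v}" "adj G u v"
  using assms by (metis adj_def card_2_iff finite_simple_graph_def)

text \<open>The walk property comes for free: consecutive entries form edges of \<open>G\<close>,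
  and with at least one step every entry lies on such an edge, hence in
  \<open>verts G\<close>.\<close>

lemma eulerian_circuitI:
  assumes "finite_simple_graph G" "length p \<ge> 2" "hd p = last p"
    "distinct (walk_edges p)" "set (walk_edges p) = edges G"
  shows "eulerian_circuit G p"
proof -
  have "\<Union> (edges G) \<subseteq> verts G"
    using assms(1) unfolding finite_simple_graph_def by blast
  then have "set p \<subseteq> verts G"
    using set_subset_walk_edges[of p] assms(2,5) by simp
  then show ?thesis
    using assms by (auto simp: eulerian_circuit_def walk_def successively_adj_iff)
qed

lemma eulerian_circuitD:
  assumes "finite_simple_graph G" "eulerian_circuit G p"
  shows "length p = Suc (card (edges G))" "card (edges G) \<ge> 2"
    "hd p = last p" "set p \<subseteq> verts G" "distinct (walk_edges p)" "set (walk_edges p) = edges G"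
    "p \<noteq> []"
proof -
  show *: "hd p = last p" "set p \<subseteq> verts G" "distinct (walk_edges p)"
    "set (walk_edges p) = edges G" "p \<noteq> []"
    using assms(2) by (auto simp: eulerian_circuit_def walk_def)
  have l: "length p \<ge> 2" using assms(2) by (simp add: eulerian_circuit_def)
  have "card (edges G) = length p - 1"
    using * distinct_card length_walk_edges by metis
  with l show len: "length p = Suc (card (edges G))" by simp
  \<comment> \<open>A closed list of length 2 would traverse a loop. The resulting bound of two
    edges later puts the last but one vertex among the interior positions.\<close>
  have "length p \<noteq> 2"
  proof
    assume "length p = 2"
    then obtain a b where "p = [a, b]" by (auto simp: length_Suc_conv numeral_2_eq_2)
    then have "{a} \<in> edges G" using * by auto
    then show False using assms(1) by (auto simp: finite_simple_graph_def)
  qed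
  with l len show "card (edges G) \<ge> 2" by simp
qed

section \<open>Relabelling vertices along an injective map\<close>

text \<open>Serves two purposes: renaming the vertices of the new graph to natural numbers, and
  applying automorphisms of \<open>G\<close> to circuits.\<close>

definition map_graph :: "('a \<Rightarrow> 'b) \<Rightarrow> 'a ugraph \<Rightarrow> 'b ugraph" where
  "map_graph g G = \<lparr>verts = g ` verts G, edges = (image g) ` edges G\<rparr>"

lemma map_graph_sel [simp]:
  "verts (map_graph g G) = g ` verts G" "edges (map_graph g G) = (image g) ` edges G"
  by (simp_all add: map_graph_def)

context
  fixes G :: "'a ugraph" and g :: "'a \<Rightarrow> 'b"
  assumes simple: "finite_simple_graph G" and inj: "inj_on g (verts G)"
begin

lemma inj_on_edges: "inj_on (image g) (edges G)"
  using simple inj_on_image_Pow[OF inj]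
  by (rule_tac inj_on_subset) (auto simp: finite_simple_graph_def)

text \<open>Adjacency is reflected because subsets of \<open>verts G\<close> with the same image
  under an injective map coincide.\<close>

lemma adj_map_graph:
  assumes "u \<in> verts G" "v \<in> verts G"
  shows "adj (map_graph g G) (g u) (g v) \<longleftrightarrow> adj G u v"
proof
  assume "adj (map_graph g G) (g u) (g v)"
  then obtain e where e: "e \<in> edges G" "g ` {u, v} = g ` e" by (auto simp: adj_def)
  then have "{u, v} = e"
    using assms simple inj by (subst (asm) inj_on_image_eq_iff) (auto simp: finite_simple_graph_def)
  then show "adj G u v" using e by (simp add: adj_def)
next
  assume "adj G u v"
  then have "g ` {u, v} \<in> (image g) ` edges G" unfolding adj_def by (rule imageI)
  then show "adj (map_graph g G) (g u) (g v)" by (simp add: adj_def)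
qed

lemma finite_simple_map_graph: "finite_simple_graph (map_graph g G)"
  using simple inj
  by (auto simp: finite_simple_graph_def card_image inj_on_subset intro!: image_mono)

lemma walk_map_graph: "walk G p \<Longrightarrow> walk (map_graph g G) (map g p)"
  by (auto simp: walk_def successively_adj_iff walk_edges_map)

lemma connected_map_graph:
  assumes "connected_graph G"
  shows "connected_graph (map_graph g G)"
  unfolding connected_graph_def
proof (intro conjI ballI)
  show "verts (map_graph g G) \<noteq> {}" using assms by (simp add: connected_graph_def)
next
  fix u v assume "u \<in> verts (map_graph g G)" "v \<in> verts (map_graph g G)"
  then obtain u' v' where uv: "u = g u'" "v = g v'" "u' \<in> verts G" "v' \<in> verts G" by auto
  then obtain p where p: "walk G p" "hd p = u'" "last p = v'"
    using assms by (auto simp: connected_graph_def)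
  then have "hd (map g p) = u" "last (map g p) = v"
    using uv by (auto simp: walk_def hd_map last_map)
  then show "\<exists>p. walk (map_graph g G) p \<and> hd p = u \<and> last p = v"
    using walk_map_graph[OF p(1)] by blast
qed

lemma regular_map_graph:
  assumes "regular_graph G d"
  shows "regular_graph (map_graph g G) d"
  unfolding regular_graph_def
proof
  fix v assume "v \<in> verts (map_graph g G)"
  then obtain v' where v: "v = g v'" "v' \<in> verts G" by auto
  have "{u. adj (map_graph g G) v u} = g ` {u. adj G v' u}"
  proof (intro equalityI subsetI)
    fix u assume "u \<in> {u. adj (map_graph g G) v u}"
    moreover from this obtain u' where "u = g u'" "u' \<in> verts G"
      using adj_verts(2)[OF finite_simple_map_graph] by auto
    ultimately show "u \<in> g ` {u. adj G v' u}" using v by (simp add: adj_map_graph)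
  next
    fix u assume "u \<in> g ` {u. adj G v' u}"
    then obtain u' where "u = g u'" "adj G v' u'" by blast
    then show "u \<in> {u. adj (map_graph g G) v u}"
      using v adj_verts(2)[OF simple] by (simp add: adj_map_graph)
  qed
  moreover have "inj_on g {u. adj G v' u}"
    using inj by (rule inj_on_subset) (use adj_verts[OF simple] in blast)
  ultimately show "vertex_degree (map_graph g G) v = d"
    using assms v by (simp add: vertex_degree_def regular_graph_def card_image)
qed

lemma eulerian_circuit_map_graph:
  assumes "eulerian_circuit G p"
  shows "eulerian_circuit (map_graph g G) (map g p)"
proof (rule eulerian_circuitI[OF finite_simple_map_graph])
  note p = eulerian_circuitD[OF simple assms]
  show "length (map g p) \<ge> 2" "hd (map g p) = last (map g p)"
    using p by (simp_all add: hd_map last_map)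
  show "distinct (walk_edges (map g p))" "set (walk_edges (map g p)) = edges (map_graph g G)"
    using p inj_on_edges by (simp_all add: walk_edges_map distinct_map)
qed

lemma avoiding_map_graph:
  assumes "avoiding G p q"
  shows "avoiding (map_graph g G) (map g p) (map g q)"
proof -
  have pq: "eulerian_circuit G p" "eulerian_circuit G q" using assms by (auto simp: avoiding_def)
  note p = eulerian_circuitD[OF simple pq(1)] and q = eulerian_circuitD[OF simple pq(2)]
  have "map g p ! i \<noteq> map g q ! i \<and> \<not> adj (map_graph g G) (map g p ! i) (map g q ! i)"
    if i: "i \<in> {1..card (edges G) - 1}" for i
  proof -
    have l: "i < length p" "i < length q" using i p q by auto
    then have "p ! i \<in> verts G" "q ! i \<in> verts G" using p q by auto
    then show ?thesis
      using assms i l inj by (auto simp: avoiding_def adj_map_graph dest: inj_onD)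
  qed
  then show ?thesis
    using assms pq p q eulerian_circuit_map_graph
    by (simp add: avoiding_def hd_map card_image inj_on_edges)
qed

lemma admits_avoiding_circuits_map_graph:
  assumes "admits_avoiding_circuits G k"
  shows "admits_avoiding_circuits (map_graph g G) k"
proof -
  obtain x C where C: "x \<in> verts G" "finite C" "card C = k"
    "\<And>p. p \<in> C \<Longrightarrow> eulerian_circuit G p \<and> hd p = x" "pairwise (avoiding G) C"
    using assms by (auto simp: admits_avoiding_circuits_def)
  note D = eulerian_circuitD[OF simple]
  have "\<Union> (set ` C) \<subseteq> verts G" using C(4) D(4) by blast
  \<comment> \<open>Distinct circuits stay distinct, so the image family still has \<open>k\<close>
    members.\<close>
  then have "inj_on (map g) C"
    by (intro inj_on_mapI inj_on_subset[OF inj])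
  moreover have "pairwise (avoiding (map_graph g G)) (map g ` C)"
    by (rule pairwise_imageI) (use C(5) avoiding_map_graph in \<open>blast dest: pairwiseD\<close>)
  moreover have "hd (map g p) = g x" if "p \<in> C" for p
    using C(4)[OF that] D(7) by (simp add: hd_map)
  ultimately show ?thesis
    unfolding admits_avoiding_circuits_def
    using C eulerian_circuit_map_graph
    by (intro bexI[of _ "g x"] exI[of _ "map g ` C"]) (auto simp: card_image)
qed

end

section \<open>The lexicographic product with two isolated vertices\<close>

text \<open>The \<open>bool\<close> coordinate is the layer. Adjacency ignores it, so each edge of
  \<open>G\<close> yields four edges, and the two copies of a vertex are non-adjacent when
  \<open>G\<close> is simple.\<close>

definition double_graph :: "'a ugraph \<Rightarrow> ('a \<times> bool) ugraph" where
  "double_graph G = \<lparr>verts = verts G \<times> UNIV,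
     edges = {{(u, a), (v, b)} | u a v b. adj G u v}\<rparr>"

lemma verts_double_graph [simp]: "verts (double_graph G) = verts G \<times> UNIV"
  by (simp add: double_graph_def)

lemma edges_double_graph: "edges (double_graph G) = {{(u, a), (v, b)} | u a v b. adj G u v}"
  by (simp add: double_graph_def)

lemma adj_double_graph [simp]: "adj (double_graph G) p q \<longleftrightarrow> adj G (fst p) (fst q)"
proof
  assume "adj (double_graph G) p q"
  then show "adj G (fst p) (fst q)"
    by (auto simp: adj_def edges_double_graph doubleton_eq_iff insert_commute)
next
  assume "adj G (fst p) (fst q)"
  then show "adj (double_graph G) p q"
    unfolding adj_def[of "double_graph G"] edges_double_graph by (cases p; cases q) auto
qed

lemma finite_simple_double_graph:
  assumes "finite_simple_graph G"
  shows "finite_simple_graph (double_graph G)"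
  unfolding finite_simple_graph_def
proof (intro conjI ballI)
  show "finite (verts (double_graph G))" using assms by (simp add: finite_simple_graph_def)
next
  fix e assume "e \<in> edges (double_graph G)"
  then show "e \<subseteq> verts (double_graph G)" "card e = 2"
    using adj_verts[OF assms] by (auto simp: edges_double_graph card_insert_if)
qed

lemma regular_double_graph:
  assumes "regular_graph G d"
  shows "regular_graph (double_graph G) (2 * d)"
proof -
  have "{q. adj (double_graph G) p q} = {v. adj G (fst p) v} \<times> UNIV" for p
    by auto
  then show ?thesis
    using assms by (auto simp: regular_graph_def vertex_degree_def card_cartesian_product)
qed

text \<open>The first step of a walk may change the layer: step from \<open>(u, a)\<close> to a
  neighbour of \<open>u\<close> in the target layer and remain there. An edge is required, since a
  single vertex would double to two isolated ones.\<close>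

lemma connected_double_graph:
  assumes G: "finite_simple_graph G" "connected_graph G" and e: "edges G \<noteq> {}"
  shows "connected_graph (double_graph G)"
  unfolding connected_graph_def
proof (intro conjI ballI)
  show "verts (double_graph G) \<noteq> {}" using G by (simp add: connected_graph_def)
next
  fix p q assume pq: "p \<in> verts (double_graph G)" "q \<in> verts (double_graph G)"
  obtain u a where p: "p = (u, a)" "u \<in> verts G" using pq by auto
  obtain v b where q: "q = (v, b)" "v \<in> verts G" using pq by auto
  \<comment> \<open>Some end of an edge differs from \<open>u\<close>; the second vertex of a walk
    towards it is a neighbour of \<open>u\<close>.\<close>
  obtain u' where u': "u' \<in> verts G" "u' \<noteq> u"
    using e edge_cases[OF G(1)] adj_verts[OF G(1)] by (metis all_not_in_conv)
  obtain w where w: "adj G u w"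
  proof -
    obtain r where r: "walk G r" "hd r = u" "last r = u'"
      using G p u' by (auto simp: connected_graph_def)
    then obtain c r' where "r = u # c # r'"
      using u' by (cases r; cases "tl r") (auto simp: walk_def)
    then show ?thesis using r that by (auto simp: walk_def)
  qed
  obtain r where r: "walk G r" "hd r = w" "last r = v"
    using G q adj_verts[OF G(1) w] by (auto simp: connected_graph_def)
  let ?r = "(u, a) # map (\<lambda>w. (w, b)) r"
  have "successively (adj (double_graph G)) (map (\<lambda>w. (w, b)) r)"
    using r by (simp add: walk_def successively_map)
  then have "walk (double_graph G) ?r"
    using r w p by (auto simp: walk_def successively_Cons hd_map)
  moreover have "hd ?r = p" "last ?r = q"
    using r p q by (auto simp: walk_def last_map)
  ultimately show "\<exists>r. walk (double_graph G) r \<and> hd r = p \<and> last r = q" by blast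
qed

section \<open>The closed trail through all edges outside layer \<open>False\<close>\<close>

text \<open>The trail \<open>T\<close> runs three times along an Eulerian circuit of length \<open>m\<close>. If at every
  position exactly one pass is in layer \<open>False\<close>, and not the same one at consecutive positions, then
  every edge is traversed once with each pair of layers other than \<open>(False, False)\<close>. Pass \<open>0\<close>
  must be in layer \<open>False\<close> at position \<open>0\<close> and pass \<open>2\<close> at position \<open>m\<close>, so that the passes join to
  a closed trail.\<close>

definition zero_pass :: "nat \<Rightarrow> nat \<Rightarrow> nat" where
  "zero_pass m t = (if t = m then 2 else t mod 2)"

lemma zero_pass_less: "zero_pass m t < 3"
  unfolding zero_pass_def by presburger

lemma zero_pass_Suc: "zero_pass m t \<noteq> zero_pass m (Suc t)"
  by (simp add: zero_pass_def) presburger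

definition pass :: "nat \<Rightarrow> 'a list \<Rightarrow> ('a \<times> bool) list" where
  "pass r p = map (\<lambda>t. (p ! t, zero_pass (length p - 1) t \<noteq> r)) [0..<length p]"

text \<open>Layers depend only on the position and the length, not on the vertices. Hence translates
  of one trail are always in the same layer at the same time.\<close>

lemma pass_map: "pass r (map g p) = map (apfst g) (pass r p)"
  by (simp add: pass_def)

lemma length_pass [simp]: "length (pass r p) = length p"
  by (simp add: pass_def)

text \<open>Two entries are needed so that position 0 is not also the last one, where
  \<open>zero_pass\<close> would be 2.\<close>

lemma hd_pass: "length p \<ge> 2 \<Longrightarrow> hd (pass r p) = (hd p, r \<noteq> 0)"
  by (cases p) (auto simp: pass_def upt_rec zero_pass_def)

lemma last_pass: "length p \<ge> 2 \<Longrightarrow> last (pass r p) = (last p, r \<noteq> 2)"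
  by (cases p) (auto simp: pass_def last_map zero_pass_def last_conv_nth)

lemma walk_edges_pass:
  "walk_edges (pass r p) =
    map (\<lambda>t. {(p ! t, zero_pass (length p - 1) t \<noteq> r),
              (p ! Suc t, zero_pass (length p - 1) (Suc t) \<noteq> r)}) [0..<length p - 1]"
  by (auto simp: walk_edges_conv_nth pass_def simp del: upt_Suc)

text \<open>On a closed \<open>p\<close>, pass 0 leads from layer \<open>False\<close> to
  \<open>True\<close>, pass 1 from \<open>True\<close> to \<open>True\<close>, and pass 2 back to
  \<open>False\<close>, so consecutive passes meet; each \<open>tl\<close> drops the repeated
  vertex.\<close>

definition three_passes :: "'a list \<Rightarrow> ('a \<times> bool) list" where
  "three_passes p = pass 0 p @ tl (pass 1 p @ tl (pass 2 p))"

lemma three_passes_map: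
  "p \<noteq> [] \<Longrightarrow> three_passes (map g p) = map (apfst g) (three_passes p)"
  by (simp add: three_passes_def pass_map map_tl)

lemma three_passes_facts:
  assumes "length p \<ge> 2" "hd p = last p"
  shows "length (three_passes p) = Suc (3 * (length p - 1))"
    "hd (three_passes p) = (hd p, False)" "last (three_passes p) = (hd p, False)"
    "walk_edges (three_passes p) =
      walk_edges (pass 0 p) @ walk_edges (pass 1 p) @ walk_edges (pass 2 p)"
proof -
  have ne: "pass r p \<noteq> []" for r using assms by (metis length_pass list.size(3) not_numeral_le_zero)
  show "length (three_passes p) = Suc (3 * (length p - 1))"
    using assms by (simp add: three_passes_def)
  show "hd (three_passes p) = (hd p, False)"
    using assms ne by (simp add: three_passes_def hd_pass)
  have "0 < length (tl (pass 2 p))" using assms by simp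
  then have "tl (pass 2 p) \<noteq> []" unfolding length_greater_0_conv .
  then show "last (three_passes p) = (hd p, False)"
    using assms ne by (simp add: three_passes_def last_pass last_tl)
  show "walk_edges (three_passes p) =
      walk_edges (pass 0 p) @ walk_edges (pass 1 p) @ walk_edges (pass 2 p)"
    unfolding three_passes_def using assms ne
    by (simp add: walk_edges_join hd_pass last_pass del: tl_append2)
qed

text \<open>At each step of \<open>p\<close> the values of \<open>zero_pass\<close> at the two ends
  are distinct members of {0, 1, 2}. The passes with these numbers have layer \<open>False\<close>
  at exactly one end each, and the third pass has \<open>True\<close> at both.\<close>

lemma three_passes_edges:
  assumes G: "finite_simple_graph G" and p: "eulerian_circuit G p"
  shows "distinct (walk_edges (three_passes p))"
    "set (walk_edges (three_passes p)) = {{(u, a), (v, b)} | u a v b. adj G u v \<and> (a \<or> b)}"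
proof -
  note D = eulerian_circuitD[OF G p]
  define m where "m = length p - 1"
  define E where "E r t = {(p ! t, zero_pass m t \<noteq> r), (p ! Suc t, zero_pass m (Suc t) \<noteq> r)}"
    for r t
  have edge: "adj G (p ! t) (p ! Suc t)" if "t < m" for t
    using D that unfolding walk_edges_conv_nth m_def adj_def by auto
  have inj: "r = q \<and> t = s" if "E r t = E q s" "t < m" "s < m" "r < 3" "q < 3" for r q t s
  proof -
    \<comment> \<open>Forgetting the layers leaves an edge of \<open>p\<close>, which
      \<open>p\<close> traverses only once; this determines the position.\<close>
    have "fst ` E r t = fst ` E q s" using that by simp
    then have "{p ! t, p ! Suc t} = {p ! s, p ! Suc s}" by (simp add: E_def)
    moreover have "inj_on (\<lambda>t. {p ! t, p ! Suc t}) {0..<m}"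
      using D(5) by (simp add: walk_edges_conv_nth distinct_map m_def)
    ultimately have ts: "t = s" using that by (auto dest: inj_onD)
    \<comment> \<open>As the ends differ, the unordered pair still tells which layer belongs to
      which end, and the two layers identify the pass.\<close>
    have "p ! t \<noteq> p ! Suc t" using adj_verts[OF G edge[OF that(2)]] by simp
    then have "(zero_pass m t \<noteq> r) = (zero_pass m t \<noteq> q)"
      "(zero_pass m (Suc t) \<noteq> r) = (zero_pass m (Suc t) \<noteq> q)"
      using that(1) ts by (auto simp: E_def doubleton_eq_iff)
    then have "r = q"
      using zero_pass_Suc[of m t] zero_pass_less[of m t] zero_pass_less[of m "Suc t"] that(4,5)
      by linarith
    with ts show ?thesis by simp
  qed
  have W: "walk_edges (three_passes p) = map (E 0) [0..<m] @ map (E 1) [0..<m] @ map (E 2) [0..<m]"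
    using D by (simp add: three_passes_facts walk_edges_pass E_def m_def)
  show "distinct (walk_edges (three_passes p))"
    unfolding W by (auto simp: distinct_map inj_on_def dest!: inj)
  have "\<exists>r<3. \<exists>t<m. E r t = {(u, a), (v, b)}" if uv: "adj G u v" "a \<or> b" for u v a b
  proof -
    have "{u, v} \<in> set (walk_edges p)" using D uv by (simp add: adj_def)
    then obtain t where t: "t < m" "{u, v} = {p ! t, p ! Suc t}"
      by (auto simp: walk_edges_conv_nth m_def)
    have "\<exists>r<3. (zero_pass m t \<noteq> r) = c \<and> (zero_pass m (Suc t) \<noteq> r) = d"
      if cd: "c \<or> d" for c d
    proof -
      consider "c" "d" | "\<not> c" "d" | "c" "\<not> d" using cd by blast
      then show ?thesis
      proof cases
        case 1
        \<comment> \<open>For layer \<open>True\<close> at both ends, take the pass that two given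
          pass numbers leave over.\<close>
        have "\<exists>r<3. i \<noteq> r \<and> j \<noteq> r" if "i < 3" "j < 3" for i j :: nat
          using that by presburger
        then show ?thesis using 1 zero_pass_less by blast
      next
        case 2 then show ?thesis using zero_pass_less zero_pass_Suc by metis
      next
        case 3 then show ?thesis using zero_pass_less zero_pass_Suc by metis
      qed
    qed
    note labels = this
    \<comment> \<open>The circuit may traverse the edge in either direction; in the second case the
      layers are requested in swapped order.\<close>
    consider "u = p ! t" "v = p ! Suc t" | "v = p ! t" "u = p ! Suc t"
      using t(2) by (auto simp: doubleton_eq_iff)
    then show ?thesis
    proof cases
      case 1
      obtain r where "r < 3" "(zero_pass m t \<noteq> r) = a" "(zero_pass m (Suc t) \<noteq> r) = b"
        using labels[OF uv(2)] by (elim exE conjE)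
      then have "E r t = {(u, a), (v, b)}" using 1 by (simp add: E_def)
      then show ?thesis using t(1) \<open>r < 3\<close> by blast
    next
      case 2
      obtain r where "r < 3" "(zero_pass m t \<noteq> r) = b" "(zero_pass m (Suc t) \<noteq> r) = a"
        using labels[OF disj_commute[THEN iffD1, OF uv(2)]] by (elim exE conjE)
      then have "E r t = {(u, a), (v, b)}" using 2 by (simp add: E_def insert_commute)
      then show ?thesis using t(1) \<open>r < 3\<close> by blast
    qed
  qed
  moreover have "\<exists>u a v b. E r t = {(u, a), (v, b)} \<and> adj G u v \<and> (a \<or> b)" if "t < m" for r t
  proof -
    have "zero_pass m t \<noteq> r \<or> zero_pass m (Suc t) \<noteq> r" using zero_pass_Suc[of m t] by metis
    then show ?thesis using edge[OF that] E_def by blast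
  qed
  moreover have "set (walk_edges (three_passes p)) = {E r t | r t. r < 3 \<and> t < m}"
    unfolding W by (auto simp: less_Suc_eq numeral_3_eq_3 numeral_2_eq_2 image_def) blast+
  ultimately show "set (walk_edges (three_passes p)) =
      {{(u, a), (v, b)} | u a v b. adj G u v \<and> (a \<or> b)}"
    by auto metis+
qed

section \<open>Eulerian circuits of the doubled graph\<close>

text \<open>Intended for a circuit \<open>q\<close> that starts at the last but one vertex of
  \<open>p\<close>: \<open>tl\<close> drops this junction, and the final entry restores the last
  edge of \<open>p\<close>.\<close>

definition double_circuit :: "'a list \<Rightarrow> 'a list \<Rightarrow> ('a \<times> bool) list" where
  "double_circuit p q = map (\<lambda>u. (u, False)) (butlast p) @ tl (three_passes q) @ [(last p, False)]"

text \<open>The lift of \<open>p\<close> covers the edges inside layer \<open>False\<close> and the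
  three passes along \<open>q\<close> cover all others, giving \<open>m + 3m\<close> edges where
  \<open>m\<close> is the number of edges of \<open>G\<close>.\<close>

lemma eulerian_double_circuit:
  assumes G: "finite_simple_graph G" and p: "eulerian_circuit G p" and q: "eulerian_circuit G q"
    and pq: "hd q = last (butlast p)"
  shows "eulerian_circuit (double_graph G) (double_circuit p q)" (is ?E)
    and "hd (double_circuit p q) = (hd p, False)" (is ?H)
    and "length (double_circuit p q) = Suc (4 * card (edges G))" (is ?L)
proof -
  note P = eulerian_circuitD[OF G p] and Q = eulerian_circuitD[OF G q]
  let ?f = "\<lambda>u. (u, False)"
  have ne: "butlast p \<noteq> []" using P by (cases p rule: rev_cases) auto
  have q2: "length q \<ge> 2" using Q by simp
  note T = three_passes_facts[OF q2 Q(3)]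
  have Tne: "three_passes q \<noteq> []" using T(1) by auto
  have "map ?f p = map ?f (butlast p @ [last p])" using P(7) by simp
  then have p_eq: "map ?f p = map ?f (butlast p) @ [?f (last p)]" by simp
  have Tsplit: "walk_edges (three_passes q @ [?f (last p)]) =
      walk_edges (three_passes q) @ [{?f (last (butlast p)), ?f (last p)}]"
    using Tne T pq by (simp add: walk_edges_append)
  have "double_circuit p q = map ?f (butlast p) @ tl (three_passes q @ [?f (last p)])"
    using Tne by (simp add: double_circuit_def)
  also have "walk_edges \<dots> = walk_edges (map ?f (butlast p)) @ walk_edges (three_passes q) @
      [{?f (last (butlast p)), ?f (last p)}]"
    using ne Tne T pq by (subst walk_edges_join) (simp_all add: last_map Tsplit del: tl_append2)
  finally have W: "walk_edges (double_circuit p q) = walk_edges (map ?f (butlast p)) @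
      walk_edges (three_passes q) @ [{?f (last (butlast p)), ?f (last p)}]" .
  \<comment> \<open>Splitting off the last edge shows that the new edge list is that of the lifted
    \<open>p\<close> with the trail inserted before its last edge.\<close>
  have Wp: "map (image ?f) (walk_edges p) =
      walk_edges (map ?f (butlast p)) @ [{?f (last (butlast p)), ?f (last p)}]"
    using ne by (simp add: walk_edges_map[symmetric] p_eq walk_edges_append last_map)
  let ?A = "(image ?f) ` edges G"
  let ?B = "{{(u, a), (v, b)} | u a v b. adj G u v \<and> (a \<or> b)}"
  have setW: "set (walk_edges (double_circuit p q)) =
      set (map (image ?f) (walk_edges p)) \<union> set (walk_edges (three_passes q))"
    unfolding W Wp by auto
  also have "\<dots> = ?A \<union> ?B"
    using three_passes_edges[OF G q] P by simp
  also have "\<dots> = edges (double_graph G)"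
  proof (intro equalityI subsetI)
    fix e assume "e \<in> ?A \<union> ?B"
    then consider "e \<in> ?A" | "e \<in> ?B" by (elim UnE)
    then show "e \<in> edges (double_graph G)"
    proof cases
      case 1
      then obtain e' where e': "e' \<in> edges G" "e = ?f ` e'" by (elim imageE)
      from edge_cases[OF G e'(1)] obtain u v where "e' = {u, v}" "adj G u v" by metis
      with e' have "adj G u v" "e = {?f u, ?f v}" by auto
      then show ?thesis unfolding edges_double_graph by blast
    next
      case 2
      then show ?thesis unfolding edges_double_graph by blast
    qed
  next
    fix e assume "e \<in> edges (double_graph G)"
    then obtain u a v b where e: "e = {(u, a), (v, b)}" "adj G u v"
      by (auto simp: edges_double_graph)
    show "e \<in> ?A \<union> ?B"
    proof (cases "a \<or> b")
      case False
      then have "e = ?f ` {u, v}" using e by simp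
      moreover have "{u, v} \<in> edges G" using e by (simp add: adj_def)
      ultimately show ?thesis by (intro UnI1 image_eqI)
    qed (use e in blast)
  qed
  finally have set: "set (walk_edges (double_circuit p q)) = edges (double_graph G)" .
  have "inj_on (image ?f) (edges G)"
    by (rule inj_on_image, rule inj_onI) simp
  then have "distinct (map (image ?f) (walk_edges p))"
    using P by (simp add: distinct_map)
  \<comment> \<open>Every member of \<open>?B\<close> contains a vertex in layer
    \<open>True\<close>, and no member of \<open>?A\<close> does.\<close>
  moreover have "?A \<inter> ?B = {}"
    by (auto simp: image_def set_eq_iff)
  then have "set (map (image ?f) (walk_edges p)) \<inter> set (walk_edges (three_passes q)) = {}"
    using three_passes_edges[OF G q] P by simp
  ultimately have dist: "distinct (walk_edges (double_circuit p q))"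
    using three_passes_edges(1)[OF G q] unfolding W Wp by auto
  show ?L
    using P Q T by (simp add: double_circuit_def)
  show ?H
    using ne by (simp add: double_circuit_def hd_map) (metis P(7) append_butlast_last_id hd_append2)
  show ?E
    using \<open>?L\<close> \<open>?H\<close> P set dist
    by (intro eulerian_circuitI finite_simple_double_graph G) (auto simp: double_circuit_def)
qed

section \<open>Translations of circulant graphs\<close>

lemma verts_cayley_graph [simp]: "verts (cayley_graph \<Gamma> S) = carrier \<Gamma>"
  by (simp add: cayley_graph_def)

text \<open>Edges arise by multiplying with \<open>S\<close> on the right, so multiplication on the
  left preserves them; translating back by the inverse gives the converse.\<close>

lemma adj_cayley_translate:
  assumes "group \<Gamma>" "S \<subseteq> carrier \<Gamma>" "c \<in> carrier \<Gamma>" "g \<in> carrier \<Gamma>" "h \<in> carrier \<Gamma>"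
  shows "adj (cayley_graph \<Gamma> S) (c \<otimes>\<^bsub>\<Gamma>\<^esub> g) (c \<otimes>\<^bsub>\<Gamma>\<^esub> h) \<longleftrightarrow> adj (cayley_graph \<Gamma> S) g h"
proof -
  interpret group \<Gamma> by fact
  have imp: "adj (cayley_graph \<Gamma> S) (c \<otimes>\<^bsub>\<Gamma>\<^esub> g) (c \<otimes>\<^bsub>\<Gamma>\<^esub> h)"
    if c: "c \<in> carrier \<Gamma>" and gh: "adj (cayley_graph \<Gamma> S) g h" for c g h
  proof -
    obtain a s where "{g, h} = {a, a \<otimes>\<^bsub>\<Gamma>\<^esub> s}" "a \<in> carrier \<Gamma>" "s \<in> S"
      using gh by (auto simp: adj_def cayley_graph_def)
    moreover from this have "{c \<otimes>\<^bsub>\<Gamma>\<^esub> g, c \<otimes>\<^bsub>\<Gamma>\<^esub> h} = {c \<otimes>\<^bsub>\<Gamma>\<^esub> a, (c \<otimes>\<^bsub>\<Gamma>\<^esub> a) \<otimes>\<^bsub>\<Gamma>\<^esub> s}"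
      using assms(2) c by (auto simp: doubleton_eq_iff m_assoc)
    ultimately show ?thesis
      using c unfolding adj_def cayley_graph_def by auto
  qed
  show ?thesis
    using imp[of c g h] imp[of "inv\<^bsub>\<Gamma>\<^esub> c" "c \<otimes>\<^bsub>\<Gamma>\<^esub> g" "c \<otimes>\<^bsub>\<Gamma>\<^esub> h"] assms(3-5)
    by (auto simp: m_assoc[symmetric])
qed

text \<open>For fixed \<open>a\<close> the map is a group translation carried over to
  \<open>G\<close>, hence an automorphism. For fixed \<open>u\<close> commutativity makes it a
  translation in \<open>a\<close> as well, which gives the last two properties.\<close>

lemma circulant_translations:
  assumes circ: "circulant_graph G n" and y: "y \<in> verts G"
  obtains \<phi> where
    "\<And>a. a \<in> verts G \<Longrightarrow> bij_betw (\<phi> a) (verts G) (verts G)"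
    "\<And>a. a \<in> verts G \<Longrightarrow> \<phi> a y = a"
    "\<And>a u v. \<lbrakk>a \<in> verts G; u \<in> verts G; v \<in> verts G\<rbrakk> \<Longrightarrow> adj G (\<phi> a u) (\<phi> a v) \<longleftrightarrow> adj G u v"
    "\<And>a b u. \<lbrakk>a \<in> verts G; b \<in> verts G; u \<in> verts G\<rbrakk> \<Longrightarrow> \<phi> a u = \<phi> b u \<longleftrightarrow> a = b"
    "\<And>a b u. \<lbrakk>a \<in> verts G; b \<in> verts G; u \<in> verts G\<rbrakk> \<Longrightarrow> adj G (\<phi> a u) (\<phi> b u) \<longleftrightarrow> adj G a b"
proof -
  define \<Gamma> where "\<Gamma> = integer_mod_group n"
  interpret comm_group \<Gamma> unfolding \<Gamma>_def by (rule abelian_integer_mod_group)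
  obtain S where S: "S \<subseteq> carrier \<Gamma>" and iso: "graph_iso G (cayley_graph \<Gamma> S)"
    using circ unfolding circulant_graph_def \<Gamma>_def by blast
  obtain f where f: "bij_betw f (verts G) (carrier \<Gamma>)"
    and adj_f: "\<And>u v. \<lbrakk>u \<in> verts G; v \<in> verts G\<rbrakk> \<Longrightarrow> adj G u v \<longleftrightarrow> adj (cayley_graph \<Gamma> S) (f u) (f v)"
    using iso unfolding graph_iso_def verts_cayley_graph by blast
  define h where "h = inv_into (verts G) f"
  have h: "bij_betw h (carrier \<Gamma>) (verts G)" unfolding h_def using f by (rule bij_betw_inv_into)
  have hf: "h (f u) = u" if "u \<in> verts G" for u
    using f that by (simp add: h_def bij_betw_inv_into_left)
  have fh: "f (h c) = c" if "c \<in> carrier \<Gamma>" for c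
    using f that by (simp add: h_def bij_betw_inv_into_right)
  have fc [simp]: "f u \<in> carrier \<Gamma>" if "u \<in> verts G" for u using f that by (rule bij_betw_apply)
  have hv [simp]: "h c \<in> verts G" if "c \<in> carrier \<Gamma>" for c using h that by (rule bij_betw_apply)
  have adj_h: "adj G (h c) (h d) \<longleftrightarrow> adj (cayley_graph \<Gamma> S) c d"
    if "c \<in> carrier \<Gamma>" "d \<in> carrier \<Gamma>" for c d
    using that by (simp add: adj_f fh)
  have h_eq: "h c = h d \<longleftrightarrow> c = d" if "c \<in> carrier \<Gamma>" "d \<in> carrier \<Gamma>" for c d
    using that by (metis fh)
  \<comment> \<open>The factor \<open>f a\<close> times the inverse of \<open>f y\<close> is the
    group element that takes \<open>f y\<close> to \<open>f a\<close>, so \<open>\<phi> a\<close>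
    sends \<open>y\<close> to \<open>a\<close>.\<close>
  define \<phi> where "\<phi> a u = h (f a \<otimes>\<^bsub>\<Gamma>\<^esub> inv\<^bsub>\<Gamma>\<^esub> (f y) \<otimes>\<^bsub>\<Gamma>\<^esub> f u)" for a u
  have swap: "\<phi> a u = h (inv\<^bsub>\<Gamma>\<^esub> (f y) \<otimes>\<^bsub>\<Gamma>\<^esub> f u \<otimes>\<^bsub>\<Gamma>\<^esub> f a)" if "a \<in> verts G" "u \<in> verts G" for a u
    using that y by (simp add: \<phi>_def m_ac)
  show thesis
  proof
    fix a assume a: "a \<in> verts G"
    show "\<phi> a y = a" using a y by (simp add: \<phi>_def m_assoc hf)
    have "bij_betw (\<lambda>c. k \<otimes>\<^bsub>\<Gamma>\<^esub> c) (carrier \<Gamma>) (carrier \<Gamma>)" if "k \<in> carrier \<Gamma>" for k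
      using that by (intro bij_betwI[where g = "\<lambda>c. inv\<^bsub>\<Gamma>\<^esub> k \<otimes>\<^bsub>\<Gamma>\<^esub> c"])
        (auto simp: m_assoc[symmetric])
    from this[of "f a \<otimes>\<^bsub>\<Gamma>\<^esub> inv\<^bsub>\<Gamma>\<^esub> (f y)"]
    have "bij_betw (\<lambda>c. f a \<otimes>\<^bsub>\<Gamma>\<^esub> inv\<^bsub>\<Gamma>\<^esub> (f y) \<otimes>\<^bsub>\<Gamma>\<^esub> c) (carrier \<Gamma>) (carrier \<Gamma>)"
      using a y by simp
    from bij_betw_trans[OF bij_betw_trans[OF f this] h]
    show "bij_betw (\<phi> a) (verts G) (verts G)"
      by (rule iffD1[OF bij_betw_cong, rotated]) (simp add: \<phi>_def)
  next
    fix a u v assume "a \<in> verts G" "u \<in> verts G" "v \<in> verts G"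
    then show "adj G (\<phi> a u) (\<phi> a v) \<longleftrightarrow> adj G u v"
      using y S by (simp add: \<phi>_def adj_h adj_f fh adj_cayley_translate group_axioms)
  next
    fix a b u assume abu: "a \<in> verts G" "b \<in> verts G" "u \<in> verts G"
    then show "adj G (\<phi> a u) (\<phi> b u) \<longleftrightarrow> adj G a b"
      using y S by (simp add: swap adj_h adj_f fh adj_cayley_translate group_axioms)
    show "\<phi> a u = \<phi> b u \<longleftrightarrow> a = b"
      using abu y by (simp add: swap h_eq) (metis hf)
  qed
qed

text \<open>The relabelled graph is \<open>G\<close> itself: edges go injectively to edges, and an
  injective self-map of a finite set is onto.\<close>

lemma eulerian_circuit_automorphism:
  assumes G: "finite_simple_graph G" and p: "eulerian_circuit G p"
    and bij: "bij_betw g (verts G) (verts G)"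
    and adj: "\<And>u v. \<lbrakk>u \<in> verts G; v \<in> verts G\<rbrakk> \<Longrightarrow> adj G (g u) (g v) \<longleftrightarrow> adj G u v"
  shows "eulerian_circuit G (map g p)"
proof -
  have inj: "inj_on g (verts G)" and im: "g ` verts G = verts G"
    using bij by (auto simp: bij_betw_def)
  have "(image g) ` edges G = edges G"
  proof (rule card_subset_eq)
    have "edges G \<subseteq> Pow (verts G)" using G by (auto simp: finite_simple_graph_def)
    then show "finite (edges G)"
      using G by (meson finite_Pow_iff finite_simple_graph_def finite_subset)
    show "(image g) ` edges G \<subseteq> edges G"
    proof
      fix e assume "e \<in> (image g) ` edges G"
      then obtain e' where "e = g ` e'" "e' \<in> edges G" by blast
      then obtain u v where uv: "e = {g u, g v}" "adj G u v" by (auto elim!: edge_cases[OF G])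
      then have "adj G (g u) (g v)" using adj adj_verts[OF G] by blast
      then show "e \<in> edges G" using uv by (simp add: adj_def)
    qed
    show "card ((image g) ` edges G) = card (edges G)"
      by (rule card_image[OF inj_on_edges[OF G inj]])
  qed
  then have "map_graph g G = G" using im by (simp add: map_graph_def)
  then show ?thesis using eulerian_circuit_map_graph[OF G inj p] by simp
qed

section \<open>Mutual avoidance and the final graph\<close>

text \<open>Before position \<open>m\<close> avoidance is inherited from the given circuits.
  Afterwards two circuits visit images of one vertex under two translations, so avoidance reduces to
  that of their last but one vertices.\<close>

lemma admits_avoiding_circuits_double_graph:
  assumes G: "finite_simple_graph G" and circ: "circulant_graph G n"
    and eul: "eulerian_graph G" and k: "admits_avoiding_circuits G k"
  shows "admits_avoiding_circuits (double_graph G) k"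
proof -
  define m where "m = card (edges G)"
  note D = eulerian_circuitD[OF G]
  obtain q where q: "eulerian_circuit G q" using eul by (auto simp: eulerian_graph_def)
  note Q = D[OF q, folded m_def]
  have "hd q \<in> verts G" using Q by auto
  from circulant_translations[OF circ this] obtain \<phi> where \<phi>:
    "\<And>a. a \<in> verts G \<Longrightarrow> bij_betw (\<phi> a) (verts G) (verts G)"
    "\<And>a. a \<in> verts G \<Longrightarrow> \<phi> a (hd q) = a"
    "\<And>a u v. \<lbrakk>a \<in> verts G; u \<in> verts G; v \<in> verts G\<rbrakk> \<Longrightarrow> adj G (\<phi> a u) (\<phi> a v) \<longleftrightarrow> adj G u v"
    "\<And>a b u. \<lbrakk>a \<in> verts G; b \<in> verts G; u \<in> verts G\<rbrakk> \<Longrightarrow> \<phi> a u = \<phi> b u \<longleftrightarrow> a = b"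
    "\<And>a b u. \<lbrakk>a \<in> verts G; b \<in> verts G; u \<in> verts G\<rbrakk> \<Longrightarrow> adj G (\<phi> a u) (\<phi> b u) \<longleftrightarrow> adj G a b"
    by blast
  obtain x C where C: "x \<in> verts G" "finite C" "card C = k"
    "\<And>p. p \<in> C \<Longrightarrow> eulerian_circuit G p" "\<And>p. p \<in> C \<Longrightarrow> hd p = x"
    "pairwise (avoiding G) C"
    using k by (auto simp: admits_avoiding_circuits_def)
  define pt where "pt p = p ! (m - 1)" for p :: "'a list"
  \<comment> \<open>The translation moves \<open>hd q\<close> to \<open>pt p\<close>, so the
    inserted trail starts where \<open>butlast p\<close> ends.\<close>
  define L where "L p = double_circuit p (map (\<phi> (pt p)) q)" for p
  have P: "length p = Suc m" "set p \<subseteq> verts G" "pt p \<in> verts G" "pt p = last (butlast p)"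
    if "p \<in> C" for p
  proof -
    note Dp = D[OF C(4)[OF that], folded m_def]
    show l: "length p = Suc m" and s: "set p \<subseteq> verts G" using Dp by auto
    have "pt p \<in> set p" unfolding pt_def using l by (intro nth_mem) simp
    then show "pt p \<in> verts G" using s by blast
    have "butlast p \<noteq> []" using l Q(2) by (metis diff_Suc_1 length_butlast list.size(3) not_numeral_le_zero)
    then show "pt p = last (butlast p)"
      using l Q(2) by (simp add: pt_def last_conv_nth nth_butlast)
  qed
  have qp: "eulerian_circuit G (map (\<phi> (pt p)) q)" "hd (map (\<phi> (pt p)) q) = last (butlast p)"
    if "p \<in> C" for p
    using eulerian_circuit_automorphism[OF G q] \<phi> P[OF that] Q by (auto simp: hd_map)
  have L: "eulerian_circuit (double_graph G) (L p)" "hd (L p) = (x, False)"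
    "length (L p) = Suc (4 * m)" if "p \<in> C" for p
    using eulerian_double_circuit[OF G C(4)[OF that] qp(1)[OF that] qp(2)[OF that]] C(5)[OF that]
    by (simp_all add: L_def m_def)
  define T where "T = three_passes q"
  have T: "length T = Suc (3 * m)" using Q by (simp add: T_def three_passes_facts)
  have T_verts: "fst (T ! i) \<in> verts G" if "i < length T" for i
  proof -
    have pass: "set (pass r q) \<subseteq> verts G \<times> UNIV" for r
      using Q by (auto simp: pass_def simp del: upt_Suc)
    have tl: "set (tl ys) \<subseteq> set ys" for ys :: "('a \<times> bool) list"
      by (cases ys) auto
    have "set T \<subseteq> verts G \<times> UNIV"
      using tl[of "pass 1 q @ tl (pass 2 q)"] tl[of "pass 2 q"] pass[of 0] pass[of 1] pass[of 2]
      unfolding T_def three_passes_def set_append by blast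
    then show ?thesis using nth_mem[OF that] by (metis mem_Sigma_iff prod.collapse subsetD)
  qed
  \<comment> \<open>The shift by 1 arises because entry 0 of \<open>T\<close> is the junction
    already present at position \<open>m - 1\<close>.\<close>
  have L_nth: "L p ! i = (if i < m then (p ! i, False) else apfst (\<phi> (pt p)) (T ! (i - m + 1)))"
    if "p \<in> C" "i < 4 * m" for p i
    using that P[OF that(1)] Q T
    by (auto simp: L_def double_circuit_def three_passes_map T_def[symmetric] nth_append
        nth_butlast nth_tl map_tl[symmetric])
  have av: "avoiding (double_graph G) (L p) (L r)" if pr: "p \<in> C" "r \<in> C" "p \<noteq> r" for p r
  proof -
    have "avoiding G p r" using C(6) pr by (auto simp: pairwise_def)
    then have sep: "p ! i \<noteq> r ! i \<and> \<not> adj G (p ! i) (r ! i)" if "1 \<le> i" "i < m" for i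
      using that by (auto simp: avoiding_def m_def)
    \<comment> \<open>Since \<open>m\<close> is at least 2, position \<open>m - 1\<close> is
      interior and avoidance applies to it.\<close>
    then have sep': "pt p \<noteq> pt r \<and> \<not> adj G (pt p) (pt r)"
      unfolding pt_def using Q(2) by auto
    have card: "card (edges (double_graph G)) = 4 * m"
      using eulerian_circuitD(1)[OF finite_simple_double_graph[OF G] L(1)[OF pr(1)]] L(3)[OF pr(1)]
      by simp
    have "L p ! i \<noteq> L r ! i \<and> \<not> adj (double_graph G) (L p ! i) (L r ! i)"
      if i: "i \<in> {1..4 * m - 1}" for i
    proof (cases "i < m")
      case True
      then show ?thesis using i sep by (simp add: L_nth pr)
    next
      case False
      have "i < 4 * m" using i Q(2) by auto
      moreover from this have "fst (T ! (i - m + 1)) \<in> verts G"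
        using False T by (intro T_verts) simp
      ultimately show ?thesis
        using False sep' \<phi>(4,5) P pr by (auto simp: L_nth prod_eq_iff)
    qed
    then show ?thesis using L pr by (simp add: avoiding_def card)
  qed
  \<comment> \<open>Equal images of distinct circuits would have to avoid themselves, which fails at
    position 1; so the new family has \<open>k\<close> members.\<close>
  have "inj_on L C"
  proof (rule inj_onI, rule ccontr)
    fix p r assume pr: "p \<in> C" "r \<in> C" "L p = L r" "p \<noteq> r"
    have "card (edges (double_graph G)) = 4 * m"
      using eulerian_circuitD(1)[OF finite_simple_double_graph[OF G] L(1)[OF pr(1)]] L(3)[OF pr(1)]
      by simp
    then show False using av[OF pr(1,2,4)] pr(3) Q(2) by (auto simp: avoiding_def)
  qed
  moreover have "pairwise (avoiding (double_graph G)) (L ` C)"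
    using av by (auto simp: pairwise_def)
  ultimately show ?thesis
    unfolding admits_avoiding_circuits_def using C L
    by (intro bexI[of _ "(x, False)"] exI[of _ "L ` C"]) (auto simp: card_image)
qed

theorem theorem13:
  fixes G :: "'a ugraph" and n d k :: nat
  assumes "finite_simple_graph G" and "connected_graph G"
    and "circulant_graph G n" and "regular_graph G d"
    and "eulerian_graph G"
    and "admits_avoiding_circuits G k"
  shows "\<exists>H :: nat ugraph. finite_simple_graph H \<and> connected_graph H \<and>
    card (verts H) = 2 * n \<and> regular_graph H (2 * d) \<and>
    admits_avoiding_circuits H k"
proof -
  let ?D = "double_graph G"
  have D: "finite_simple_graph ?D" by (rule finite_simple_double_graph[OF assms(1)])
  \<comment> \<open>A finite vertex set embeds into the natural numbers, which provides the required
    vertex type.\<close>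
  then obtain g :: "'a \<times> bool \<Rightarrow> nat" where g: "inj_on g (verts ?D)"
    using finite_imp_inj_to_nat_seg[of "verts ?D"] by (auto simp: finite_simple_graph_def)
  have "card (verts G) = n"
    using assms(3) bij_betw_same_card
    by (fastforce simp: circulant_graph_def graph_iso_def carrier_integer_mod_group)
  then have "card (verts (map_graph g ?D)) = 2 * n"
    using g by (simp add: card_image card_cartesian_product)
  \<comment> \<open>An Eulerian circuit has edges by definition; connectedness of the doubled graph
    depends on this.\<close>
  moreover have "edges G \<noteq> {}"
    using assms(1,5) eulerian_circuitD(2) unfolding eulerian_graph_def by fastforce
  ultimately show ?thesis
    using finite_simple_map_graph[OF D g] connected_map_graph[OF D g] regular_map_graph[OF D g]
      admits_avoiding_circuits_map_graph[OF D g] connected_double_graph regular_double_graph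
      admits_avoiding_circuits_double_graph assms
    by blast
qed

end
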